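(* Let $\Sigma$ be a finite alphabet and $\varPhi : \Sigma^\omega \to \mathbb{D}$ a $\sup$-closed property, where the value domain satisfies $\sup \mathbb{D} = \top = \sup_{w \in \Sigma^\omega} \varPhi(w)$. Then the following are equivalent: $\varPhi$ is live; $\varPhi$ is top live; $\varPhi$ is threshold live.
   Context: $\Sigma^*$ and $\Sigma^\omega$ are the sets of finite and infinite words over the finite nonempty alphabet $\Sigma$; $u \prec w$ means that the finite word $u$ is a strict prefix of $w$ (the empty word is allowed). A value domain $\mathbb{D}$ is a complete lattice. A property is a total function $\varPhi : \Sigma^\omega \to \mathbb{D}$. $\varPhi$ is $\sup$-closed when for every $u \in \Sigma^*$ there is $w \in \Sigma^\omega$ with $\varPhi(uw) = \sup_{w' \in \Sigma^\omega} \varPhi(uw')$. $\varPhi$ is live when for all $w \in \Sigma^\omega$, if $\varPhi(w) < \top$, then there exists $v \in \mathbb{D}$ such that $\varPhi(w) \not\geq v$ and for all prefixes $u \prec w$ we have $\sup_{w' \in \Sigma^\omega} \varPhi(uw') \geq v$. $\varPhi$ is top live when $\inf_{u \prec w} \sup_{w' \in \Sigma^\omega} \varPhi(uw') = \top$ for every $w \in \Sigma^\omega$. $\varPhi$ is threshold live when for every $u \in \Sigma^*$ and $v \in \mathbb{D}$ there exists $w \in \Sigma^\omega$ such that $\varPhi(uw) \geq v$. *)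

theory Defs
  imports Main "HOL-Library.Omega_Words_Fun"
begin

text \<open>
  The alphabet is a type \<open>'a\<close> (of class \<open>finite\<close> in the theorem; types are nonempty), the value
  domain is a type \<open>'d\<close> of class \<open>complete_lattice\<close>, and a property is a total function
  \<open>'a word \<Rightarrow> 'd\<close> on infinite words, where \<open>'a word = nat \<Rightarrow> 'a\<close>.
\<close>

text \<open>
  Since \<open>u\<close> is finite and \<open>w\<close> infinite, every prefix of \<open>w\<close> is automatically a strict one.
\<close>
definition prefix_of :: "'a list \<Rightarrow> 'a word \<Rightarrow> bool"  (infix \<open>\<prec>\<close> 50)
  where "u \<prec> w \<longleftrightarrow> (\<exists>w'. w = u \<frown> w')"

definition sup_closed :: "('a word \<Rightarrow> 'd::complete_lattice) \<Rightarrow> bool"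
  where "sup_closed \<Phi> \<longleftrightarrow> (\<forall>u. \<exists>w. \<Phi> (u \<frown> w) = (SUP w'. \<Phi> (u \<frown> w')))"

definition live :: "('a word \<Rightarrow> 'd::complete_lattice) \<Rightarrow> bool"
  where "live \<Phi> \<longleftrightarrow>
    (\<forall>w. \<Phi> w < top \<longrightarrow> (\<exists>v. \<not> \<Phi> w \<ge> v \<and> (\<forall>u. u \<prec> w \<longrightarrow> (SUP w'. \<Phi> (u \<frown> w')) \<ge> v)))"

definition top_live :: "('a word \<Rightarrow> 'd::complete_lattice) \<Rightarrow> bool"
  where "top_live \<Phi> \<longleftrightarrow> (\<forall>w. (INF u\<in>{u. u \<prec> w}. SUP w'. \<Phi> (u \<frown> w')) = top)"

definition threshold_live :: "('a word \<Rightarrow> 'd::complete_lattice) \<Rightarrow> bool"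
  where "threshold_live \<Phi> \<longleftrightarrow> (\<forall>u v. \<exists>w. \<Phi> (u \<frown> w) \<ge> v)"

end

theory Submission
  imports Defs
begin

text \<open>
  For a \<open>sup\<close>-closed property, each kind of liveness says that the supremum over the extensions of
  every finite word is \<open>top\<close>. For liveness, if the supremum over the extensions of \<open>u\<close> were not
  \<open>top\<close>, then an extension attaining it would have a witness \<open>v\<close> that is below this supremum,
  because \<open>u\<close> is a prefix, but not below the value attained, which is that same supremum.
\<close>

lemma prefix_of_conc: "u \<prec> u \<frown> w"
  unfolding prefix_of_def by blast

text \<open>An infimum is \<open>top\<close> exactly when all its members are, and every finite word
  is a prefix of some infinite word.\<close>

lemma top_live_iff:
  fixes \<Phi> :: "'a word \<Rightarrow> 'd::complete_lattice"
  shows "top_live \<Phi> \<longleftrightarrow> (\<forall>u. (SUP w. \<Phi> (u \<frown> w)) = top)"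
proof
  assume "top_live \<Phi>"
  show "\<forall>u. (SUP w. \<Phi> (u \<frown> w)) = top"
  proof
    fix u :: "'a list"
    fix w :: "'a word"
    have "(INF u'\<in>{u'. u' \<prec> u \<frown> w}. SUP w'. \<Phi> (u' \<frown> w')) \<le> (SUP w'. \<Phi> (u \<frown> w'))"
      by (rule INF_lower) (simp add: prefix_of_conc)
    with \<open>top_live \<Phi>\<close> show "(SUP w'. \<Phi> (u \<frown> w')) = top"
      unfolding top_live_def by (simp add: top_le)
  qed
qed (simp add: top_live_def)

text \<open>The witness is \<open>v = top\<close>, which no value below \<open>top\<close>
  reaches.\<close>

lemma top_live_imp_live: "top_live \<Phi> \<Longrightarrow> live \<Phi>"
  unfolding top_live_iff live_def by (metis less_le_not_le top_greatest)

lemma live_imp_top_live: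
  assumes "sup_closed \<Phi>" "live \<Phi>"
  shows "top_live \<Phi>"
  unfolding top_live_iff
proof (rule allI, rule ccontr)
  fix u
  assume "(SUP w. \<Phi> (u \<frown> w)) \<noteq> top"
  moreover obtain w where w: "\<Phi> (u \<frown> w) = (SUP w'. \<Phi> (u \<frown> w'))"
    using \<open>sup_closed \<Phi>\<close> unfolding sup_closed_def by blast
  ultimately have "\<Phi> (u \<frown> w) < top"
    by (simp add: less_top)
  then obtain v where "\<not> v \<le> \<Phi> (u \<frown> w)" "v \<le> (SUP w'. \<Phi> (u \<frown> w'))"
    using \<open>live \<Phi>\<close> prefix_of_conc unfolding live_def by blast
  with w show False by simp
qed

text \<open>The threshold \<open>v = top\<close> yields an extension of value
  \<open>top\<close>.\<close>

lemma threshold_live_imp_top_live: "threshold_live \<Phi> \<Longrightarrow> top_live \<Phi>"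
  unfolding top_live_iff threshold_live_def by (meson SUP_upper2 UNIV_I top_le)

text \<open>An extension attaining the supremum \<open>top\<close> meets every threshold at
  once.\<close>

lemma top_live_imp_threshold_live:
  assumes "sup_closed \<Phi>" "top_live \<Phi>"
  shows "threshold_live \<Phi>"
  using assms unfolding top_live_iff sup_closed_def threshold_live_def
  by (metis top_greatest)

theorem theorem5p21:
  fixes \<Phi> :: "'a::finite word \<Rightarrow> 'd::complete_lattice"
  assumes "sup_closed \<Phi>"
    and "Sup (UNIV :: 'd set) = top"
    and "top = (SUP w. \<Phi> w)"
  shows "(live \<Phi> \<longleftrightarrow> top_live \<Phi>) \<and> (top_live \<Phi> \<longleftrightarrow> threshold_live \<Phi>)"
  using assms(1) top_live_imp_live live_imp_top_live threshold_live_imp_top_live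
    top_live_imp_threshold_live by blast

end
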